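(* Let $h$ be a continuous map from $[0,1]$ onto itself. Suppose there exist nondegenerate closed intervals $\mathcal{I}_0,\mathcal{I}_1,\mathcal{I}_2\subseteq[0,1]$ such that $\mathcal{I}_1\subset\mathcal{I}_0$, $\mathcal{I}_2\subset\mathcal{I}_0$, the interiors of $\mathcal{I}_1$ and $\mathcal{I}_2$ are disjoint, and $h(\mathcal{I}_1)=h(\mathcal{I}_2)=\mathcal{I}_0$. Then there exists a periodic point $x_0\in\mathcal{I}_0$ of $h$ of period $3$.
   Context: The period of a periodic point $x$ of $h$ is the least positive integer $p$ such that $h^p(x)=x$, where $h^p$ is the $p$-fold iterate of $h$. *)

theory Defs
  imports "HOL-Analysis.Analysis"
begin

definition nondegenerate_closed_interval :: "real set \<Rightarrow> bool" where
  "nondegenerate_closed_interval I \<longleftrightarrow> (\<exists>a b. a < b \<and> I = {a..b})"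

definition periodic_point :: "('a \<Rightarrow> 'a) \<Rightarrow> 'a \<Rightarrow> bool" where
  "periodic_point h x \<longleftrightarrow> (\<exists>p>0. (h ^^ p) x = x)"

(* Only meaningful when x is a periodic point of h; otherwise the value is unspecified. *)
definition period :: "('a \<Rightarrow> 'a) \<Rightarrow> 'a \<Rightarrow> nat" where
  "period h x = (LEAST p. p > 0 \<and> (h ^^ p) x = x)"

end

theory Submission
  imports Defs
begin

text \<open>
  Shrink \<open>I\<^sub>1\<close> to a segment \<open>L\<close> whose end points are mapped to the end points of \<open>I\<^sub>0\<close>. Then no
  fixed point lies in \<open>L \<inter> I\<^sub>2\<close>: it would be a common boundary point of \<open>I\<^sub>1\<close> and \<open>I\<^sub>2\<close>, hence an end
  point of \<open>L\<close>, hence an end point of \<open>I\<^sub>0\<close>, and two subintervals of \<open>I\<^sub>0\<close> with a common end point of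
  \<open>I\<^sub>0\<close> overlap. Since \<open>L\<close> and \<open>I\<^sub>2\<close> both cover \<open>I\<^sub>0\<close>, the loop \<open>L \<rightarrow> L \<rightarrow> I\<^sub>2 \<rightarrow> L\<close> yields a
  fixed point \<open>x\<close> of the third iterate with \<open>x, h x \<in> L\<close> and \<open>h (h x) \<in> I\<^sub>2\<close>. Its period divides
  \<open>3\<close>, and it is not \<open>1\<close>.
\<close>

lemma segment_subset_continuous_image:
  fixes f :: "real \<Rightarrow> real"
  assumes "continuous_on {s..t} f" "s \<le> t"
  shows "closed_segment (f s) (f t) \<subseteq> f ` {s..t}"
proof -
  have "connected (f ` {s..t})"
    using assms(1) by (intro connected_continuous_image) auto
  moreover have "f s \<in> f ` {s..t}" "f t \<in> f ` {s..t}"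
    using assms(2) by auto
  ultimately show ?thesis
    by (metis connected_contains_Icc closed_segment_eq_real_ivl)
qed

text \<open>Cut off excursions beyond the end values: \<open>t'\<close> is the first point where
  \<open>f\<close> takes the value \<open>f t\<close>, and \<open>s'\<close> the last point before
  \<open>t'\<close> where it takes the value \<open>f s\<close>.\<close>

lemma subinterval_image_eq_segment:
  fixes f :: "real \<Rightarrow> real"
  assumes cont: "continuous_on {s..t} f" and "s \<le> t"
  obtains s' t' where "s \<le> s'" "s' \<le> t'" "t' \<le> t" "f ` {s'..t'} = closed_segment (f s) (f t)"
proof -
  have compact: "compact {x\<in>{s..u}. f x = y}" if "u \<le> t" for u y
    unfolding compact_eq_bounded_closed
  proof
    show "bounded {x\<in>{s..u}. f x = y}" by (rule bounded_subset[of "{s..u}"]) auto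
    have "continuous_on {s..u} f" using continuous_on_subset[OF cont] that by auto
    then show "closed {x\<in>{s..u}. f x = y}"
      by (rule continuous_closed_preimage_constant) simp
  qed
  have "compact {x\<in>{s..t}. f x = f t}" using compact by simp
  moreover have "{x\<in>{s..t}. f x = f t} \<noteq> {}" using \<open>s \<le> t\<close> by auto
  ultimately obtain t' where t': "t' \<in> {s..t}" "f t' = f t"
    and t'_least: "\<And>x. x \<in> {s..t} \<Longrightarrow> f x = f t \<Longrightarrow> t' \<le> x"
    using compact_attains_inf[of "{x\<in>{s..t}. f x = f t}"] by auto
  have "compact {x\<in>{s..t'}. f x = f s}" using compact t' by simp
  moreover have "{x\<in>{s..t'}. f x = f s} \<noteq> {}" using t' by auto
  ultimately obtain s' where s': "s' \<in> {s..t'}" "f s' = f s"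
    and s'_greatest: "\<And>x. x \<in> {s..t'} \<Longrightarrow> f x = f s \<Longrightarrow> x \<le> s'"
    using compact_attains_sup[of "{x\<in>{s..t'}. f x = f s}"] by auto
  have cont': "continuous_on {u..v} f" if "s \<le> u" "v \<le> t" for u v
    using continuous_on_subset[OF cont] that by auto
  have "f x \<in> closed_segment (f s) (f t)" if x: "x \<in> {s'..t'}" for x
  proof (rule ccontr)
    assume nmem: "f x \<notin> closed_segment (f s) (f t)"
    \<comment> \<open>A value beyond \<open>f s\<close> would force \<open>f\<close> to take the
      value \<open>f s\<close> again on the way to \<open>t'\<close>; a value beyond
      \<open>f t\<close> would force it to take \<open>f t\<close> already on the way from
      \<open>s'\<close>.\<close>
    then consider "f s \<in> closed_segment (f x) (f t')" | "f t \<in> closed_segment (f s') (f x)"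
      using s' t' by (auto simp: closed_segment_eq_real_ivl split: if_splits)
    then show False
    proof cases
      case 1
      then obtain y where "y \<in> {x..t'}" "f y = f s"
        using segment_subset_continuous_image[of x t' f] cont'[of x t'] x s' t' by auto
      then have "y = x" using s'_greatest[of y] x s' by auto
      with \<open>f y = f s\<close> nmem show False by auto
    next
      case 2
      then obtain y where "y \<in> {s'..x}" "f y = f t"
        using segment_subset_continuous_image[of s' x f] cont'[of s' x] x s' t' by auto
      then have "y = x" using t'_least[of y] x s' t' by auto
      with \<open>f y = f t\<close> nmem show False by auto
    qed
  qed
  moreover have "closed_segment (f s) (f t) \<subseteq> f ` {s'..t'}"
    using segment_subset_continuous_image[of s' t' f] cont'[of s' t'] s' t' by auto
  ultimately have "f ` {s'..t'} = closed_segment (f s) (f t)" by auto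
  with that[of s' t'] s' t' show ?thesis by auto
qed

text \<open>Apply the trimming between a preimage of \<open>c\<close> and a preimage of
  \<open>d\<close>. Their order is unknown, hence \<open>min\<close> and \<open>max\<close>.\<close>

lemma covered_interval_is_image:
  fixes f :: "real \<Rightarrow> real"
  assumes cont: "continuous_on {a..b} f" and "c \<le> d" and cover: "{c..d} \<subseteq> f ` {a..b}"
  obtains a' b' where "a' \<le> b'" "{a'..b'} \<subseteq> {a..b}" "f ` {a'..b'} = {c..d}"
proof -
  obtain s t where s: "s \<in> {a..b}" "f s = c" and t: "t \<in> {a..b}" "f t = d"
    using cover[THEN subsetD, of c] cover[THEN subsetD, of d] \<open>c \<le> d\<close> by auto
  have "continuous_on {min s t..max s t} f"
    using continuous_on_subset[OF cont] s t by auto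
  then obtain a' b' where "min s t \<le> a'" "a' \<le> b'" "b' \<le> max s t"
    "f ` {a'..b'} = closed_segment (f (min s t)) (f (max s t))"
    by (rule subinterval_image_eq_segment) simp
  moreover have "closed_segment (f (min s t)) (f (max s t)) = {c..d}"
    using s t \<open>c \<le> d\<close> by (auto simp: closed_segment_eq_real_ivl min_def max_def)
  ultimately show ?thesis using s t by (intro that[of a' b']) auto
qed

lemma self_covering_interval_has_fixed_point:
  fixes g :: "real \<Rightarrow> real"
  assumes cont: "continuous_on {a..b} g" and "a \<le> b" and cover: "{a..b} \<subseteq> g ` {a..b}"
  obtains x where "x \<in> {a..b}" "g x = x"
proof -
  obtain s t where s: "s \<in> {a..b}" "g s = a" and t: "t \<in> {a..b}" "g t = b"
    using cover[THEN subsetD, of a] cover[THEN subsetD, of b] \<open>a \<le> b\<close> by auto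
  \<comment> \<open>\<open>g x - x\<close> is at most 0 at the preimage \<open>s\<close> of
    \<open>a\<close> and at least 0 at the preimage \<open>t\<close> of \<open>b\<close>, so it
    vanishes somewhere.\<close>
  have "connected ((\<lambda>x. g x - x) ` {a..b})"
    by (intro connected_continuous_image continuous_intros cont) auto
  moreover have "g s - s \<in> (\<lambda>x. g x - x) ` {a..b}" "g t - t \<in> (\<lambda>x. g x - x) ` {a..b}"
    using s t by blast+
  ultimately have "{g s - s..g t - t} \<subseteq> (\<lambda>x. g x - x) ` {a..b}"
    by (rule connected_contains_Icc)
  moreover have "0 \<in> {g s - s..g t - t}" using s t by auto
  ultimately have "0 \<in> (\<lambda>x. g x - x) ` {a..b}" by (rule subsetD)
  then obtain x where "x \<in> {a..b}" "g x - x = 0" by auto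
  then show ?thesis using that by auto
qed

lemma period_eq_3I:
  assumes "h (h (h x)) = x" "h x \<noteq> x"
  shows "periodic_point h x \<and> period h x = 3"
proof -
  have iter: "(h ^^ 3) x = x" using assms by (simp add: eval_nat_numeral)
  have "3 \<le> p" if "p > 0" "(h ^^ p) x = x" for p
  proof (rule ccontr)
    assume "\<not> 3 \<le> p"
    \<comment> \<open>If \<open>p = 2\<close>, applying \<open>h\<close> to
      \<open>h (h x) = x\<close> gives \<open>h (h (h x)) = h x\<close>, so again
      \<open>h x = x\<close>.\<close>
    then consider "p = 1" | "p = 2" using \<open>p > 0\<close> by fastforce
    then show False
      using that assms by cases (auto simp: eval_nat_numeral)
  qed
  then have "period h x = 3"
    unfolding period_def using iter by (intro Least_equality) auto
  with iter show ?thesis unfolding periodic_point_def by (metis zero_less_numeral)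
qed

lemma period_3_of_covering_intervals:
  fixes h :: "real \<Rightarrow> real"
  assumes cont1: "continuous_on {a1..b1} h" and cont2: "continuous_on {a2..b2} h"
    and le: "a1 \<le> b1"
    and cover11: "{a1..b1} \<subseteq> h ` {a1..b1}" and cover12: "{a2..b2} \<subseteq> h ` {a1..b1}"
    and cover21: "{a1..b1} \<subseteq> h ` {a2..b2}"
    and no_fix: "\<And>x. x \<in> {a1..b1} \<Longrightarrow> x \<in> {a2..b2} \<Longrightarrow> h x \<noteq> x"
  shows "\<exists>x\<in>{a1..b1}. periodic_point h x \<and> period h x = 3"
proof -
  \<comment> \<open>The loop is pulled back from its end: each interval is chosen to map exactly
    onto the one chosen before it, so the third iterate maps \<open>{c0..d0}\<close> onto
    \<open>{a1..b1}\<close>, which contains \<open>{c0..d0}\<close>.\<close>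
  obtain c2 d2 where 2: "c2 \<le> d2" "{c2..d2} \<subseteq> {a2..b2}" "h ` {c2..d2} = {a1..b1}"
    using covered_interval_is_image[OF cont2 le cover21] .
  then obtain c1 d1 where 1: "c1 \<le> d1" "{c1..d1} \<subseteq> {a1..b1}" "h ` {c1..d1} = {c2..d2}"
    using covered_interval_is_image[OF cont1 2(1)] cover12 by (metis order_trans)
  then obtain c0 d0 where 0: "c0 \<le> d0" "{c0..d0} \<subseteq> {a1..b1}" "h ` {c0..d0} = {c1..d1}"
    using covered_interval_is_image[OF cont1 1(1)] cover11 by (metis order_trans)
  have "continuous_on {c0..d0} (h \<circ> (h \<circ> h))"
    using continuous_on_subset[OF cont1 0(2)] continuous_on_subset[OF cont1 1(2)]
      continuous_on_subset[OF cont2 2(2)] 0(3) 1(3)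
    by (intro continuous_on_compose) (simp_all only: image_comp[symmetric])
  moreover have "(h \<circ> (h \<circ> h)) ` {c0..d0} = {a1..b1}"
    using 0 1 2 by (simp only: image_comp[symmetric])
  ultimately obtain x where x: "x \<in> {c0..d0}" "(h \<circ> (h \<circ> h)) x = x"
    using self_covering_interval_has_fixed_point[of c0 d0 "h \<circ> (h \<circ> h)"] 0 by auto
  have hx: "h x \<in> {c1..d1}" using x 0 by blast
  then have hhx: "h (h x) \<in> {a2..b2}" using 1 2 by blast
  have "x \<in> {a1..b1}" using x(1) 0(2) by blast
  \<comment> \<open>If \<open>h x = x\<close>, then \<open>x = h (h x)\<close> would be a fixed
    point lying in both intervals.\<close>
  moreover have "h x \<noteq> x"
    using no_fix[OF \<open>x \<in> {a1..b1}\<close>] hhx by auto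
  ultimately show ?thesis using period_eq_3I[of h x] x(2) by (metis comp_apply)
qed

theorem theorem13:
  fixes h :: "real \<Rightarrow> real" and I\<^sub>0 I\<^sub>1 I\<^sub>2 :: "real set"
  assumes "continuous_on {0..1} h"
    and "h ` {0..1} = {0..1}"
    and "nondegenerate_closed_interval I\<^sub>0"
    and "nondegenerate_closed_interval I\<^sub>1"
    and "nondegenerate_closed_interval I\<^sub>2"
    and "I\<^sub>0 \<subseteq> {0..1}" and "I\<^sub>1 \<subseteq> {0..1}" and "I\<^sub>2 \<subseteq> {0..1}"
    and "I\<^sub>1 \<subset> I\<^sub>0" and "I\<^sub>2 \<subset> I\<^sub>0"
    and "interior I\<^sub>1 \<inter> interior I\<^sub>2 = {}"
    and "h ` I\<^sub>1 = I\<^sub>0" and "h ` I\<^sub>2 = I\<^sub>0"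
  shows "\<exists>x\<^sub>0\<in>I\<^sub>0. periodic_point h x\<^sub>0 \<and> period h x\<^sub>0 = 3"
proof -
  obtain p q where I0: "p < q" "I\<^sub>0 = {p..q}"
    using assms(3) unfolding nondegenerate_closed_interval_def by auto
  obtain a1 b1 where I1: "a1 < b1" "I\<^sub>1 = {a1..b1}"
    using assms(4) unfolding nondegenerate_closed_interval_def by auto
  obtain a2 b2 where I2: "a2 < b2" "I\<^sub>2 = {a2..b2}"
    using assms(5) unfolding nondegenerate_closed_interval_def by auto
  have disj: "b1 \<le> a2 \<or> b2 \<le> a1"
  proof (rule ccontr)
    assume "\<not> (b1 \<le> a2 \<or> b2 \<le> a1)"
    then have "max a1 a2 < min b1 b2" using I1(1) I2(1) by auto
    then obtain z where "max a1 a2 < z" "z < min b1 b2" using dense by blast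
    then have "z \<in> interior I\<^sub>1 \<inter> interior I\<^sub>2" using I1(2) I2(2) by simp
    with assms(11) show False by blast
  qed
  have sub: "p \<le> a1" "b1 \<le> q" "p \<le> a2" "b2 \<le> q"
    using assms(9,10) I0 I1 I2 by auto
  obtain u v where u: "u \<in> {a1..b1}" "h u = p" and v: "v \<in> {a1..b1}" "h v = q"
    using equalityD2[OF assms(12), THEN subsetD, of p] equalityD2[OF assms(12), THEN subsetD, of q]
      I0 I1 by auto
  define c d where "c = min u v" and "d = max u v"
  have cd: "c \<le> d" "{c..d} \<subseteq> {a1..b1}" using u v by (auto simp: c_def d_def)
  have cont1: "continuous_on {c..d} h" and cont2: "continuous_on {a2..b2} h"
    using continuous_on_subset[OF assms(1)] assms(7,8) I1 I2 cd by (metis order_trans)+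
  have "closed_segment (h c) (h d) = {p..q}"
    using u v I0 by (auto simp: c_def d_def closed_segment_eq_real_ivl min_def max_def)
  then have cover: "{p..q} \<subseteq> h ` {c..d}"
    using segment_subset_continuous_image[OF cont1 cd(1)] by simp
  have no_fix: "h x \<noteq> x" if x: "x \<in> {c..d}" "x \<in> {a2..b2}" for x
  proof
    assume "h x = x"
    \<comment> \<open>By \<open>disj\<close> the two intervals share at most one point,
      \<open>b1 = a2\<close> or \<open>b2 = a1\<close>. As \<open>{c..d}\<close> lies within
      \<open>{a1..b1}\<close>, such a point is \<open>d\<close> or \<open>c\<close>
      respectively.\<close>
    have "x = c \<or> x = d"
      using x disj cd by auto
    then have "x = p \<or> x = q"
      using u v \<open>h x = x\<close> by (auto simp: c_def d_def min_def max_def split: if_splits)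
    \<comment> \<open>The shared point has a nondegenerate interval on either side of it within
      \<open>{p..q}\<close>, so it lies strictly between \<open>p\<close> and
      \<open>q\<close>.\<close>
    then show False
      using x disj cd sub I1(1) I2(1) by auto
  qed
  have "\<exists>x\<in>{c..d}. periodic_point h x \<and> period h x = 3"
    by (rule period_3_of_covering_intervals[OF cont1 cont2])
       (use cd cover sub I0 I2 assms(13) no_fix in auto)
  moreover have "{c..d} \<subseteq> I\<^sub>0" using cd I0 sub by auto
  ultimately show ?thesis by blast
qed

end
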